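(* Let $\mathbb S=\langle X_\alpha;r_\alpha^\beta;\omega_1\rangle$ be a continuous inverse sequence such that each $X_\alpha$ ($\alpha<\omega_1$) is a compact metric space and each $r_\alpha^{\alpha+1}\colon X_{\alpha+1}\to X_\alpha$ is a retraction. Then $X=\varprojlim\mathbb S$ is Valdivia compact.
   Context: All spaces are Hausdorff and "map" means continuous map. For a set $T$, $\Sigma(T)=\{x\in[0,1]^T: \{\alpha\in T: x(\alpha)\neq 0\}\text{ is countable}\}$. A compact space $X$ is Valdivia compact if for some set $T$ there is an embedding $h\colon X\to[0,1]^T$ with $h[X]=\operatorname{cl}(\Sigma(T)\cap h[X])$, the closure being taken in $[0,1]^T$. A retraction is a map $r\colon X\to Y$ having a right inverse, i.e. a map $g\colon Y\to X$ with $rg=\mathrm{id}_Y$. An inverse sequence $\langle X_\alpha;r_\alpha^\beta;\omega_1\rangle$ is an inverse system of compact spaces with surjective bonding maps $r_\alpha^\beta\colon X_\beta\to X_\alpha$ ($\alpha\le\beta<\omega_1$) indexed by the ordinal $\omega_1$. It is continuous if, for every directed $T\subseteq\omega_1$ and $\delta<\omega_1$ with $\delta=\sup T$, $X_\delta$ together with the maps $r^\delta_\alpha$ ($\alpha\in T$) is the limit of the system restricted to $T$. *)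

theory Defs
  imports "HOL-Analysis.Analysis" "HOL-Library.Countable_Set_Type"
begin

section \<open>The ordinal \<open>\<omega>\<^sub>1\<close>\<close>

text \<open>
  As an ordered set, \<open>\<omega>\<^sub>1\<close> is the cardinal successor of \<open>\<omega>\<close>. Up to isomorphism it is the only
  uncountable well-order whose proper initial segments are countable, see
  \<open>uncountable_UNIV_omega1\<close> and \<open>countable_lessThan_omega1\<close> below.
\<close>

lemma cardSuc_natLeq:
  includes cardinal_syntax
  shows "Card_order (cardSuc natLeq)" "natLeq <o cardSuc natLeq" "Well_order (cardSuc natLeq)"
  by (simp_all add: cardSuc_Card_order cardSuc_greater natLeq_Card_order card_order_on_well_order_on)

lemma uncountable_Field_cardSuc_natLeq: "uncountable (Field (cardSuc natLeq))"
  including cardinal_syntax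
proof
  assume "countable (Field (cardSuc natLeq))"
  then have "|Field (cardSuc natLeq)| \<le>o natLeq"
    by (simp add: countable_card_le_natLeq)
  then have "cardSuc natLeq \<le>o natLeq"
    using card_of_Field_ordIso[OF cardSuc_natLeq(1)] ordIso_ordLeq_trans ordIso_symmetric by blast
  then show False
    using cardSuc_natLeq(2) not_ordLess_ordLeq by blast
qed

typedef omega1 = "Field (cardSuc natLeq)"
  using uncountable_Field_cardSuc_natLeq by (metis countable_empty ex_in_conv)

setup_lifting type_definition_omega1

instantiation omega1 :: wellorder
begin

lift_definition less_eq_omega1 :: "omega1 \<Rightarrow> omega1 \<Rightarrow> bool"
  is "\<lambda>a b. (a, b) \<in> cardSuc natLeq" .

definition less_omega1 :: "omega1 \<Rightarrow> omega1 \<Rightarrow> bool"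
  where "less_omega1 a b \<longleftrightarrow> a \<le> b \<and> \<not> b \<le> a"

instance
proof
  let ?r = "cardSuc natLeq"
  have r: "refl_on (Field ?r) ?r" "trans ?r" "antisym ?r" "total_on (Field ?r) ?r" "wf (?r - Id)"
    using cardSuc_natLeq(3)
    by (auto simp: well_order_on_def linear_order_on_def partial_order_on_def preorder_on_def)
  fix a b c :: omega1
  show "a < b \<longleftrightarrow> a \<le> b \<and> \<not> b \<le> a"
    by (rule less_omega1_def)
  show refl: "a \<le> a"
    by transfer (use r(1) in \<open>auto dest: refl_onD\<close>)
  show "a \<le> b \<Longrightarrow> b \<le> c \<Longrightarrow> a \<le> c"
    by transfer (use r(2) in \<open>auto dest: transD\<close>)
  show anti: "a \<le> b \<Longrightarrow> b \<le> a \<Longrightarrow> a = b" for a b :: omega1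
    by transfer (use r(3) in \<open>auto dest: antisymD\<close>)
  show "a \<le> b \<or> b \<le> a"
    by transfer (metis r(1,4) total_on_def refl_onD)
  fix P and a :: omega1
  assume step: "\<And>x::omega1. (\<And>y. y < x \<Longrightarrow> P y) \<Longrightarrow> P x"
  have wf: "wf (inv_image (?r - Id) Rep_omega1)"
    using r(5) by (rule wf_inv_image)
  show "P a"
  proof (induction a rule: wf_induct_rule[OF wf])
    case (1 x)
    have "(y, x) \<in> inv_image (?r - Id) Rep_omega1" if "y < x" for y
      using that by (auto simp: less_omega1_def less_eq_omega1.rep_eq Rep_omega1_inject)
    then show ?case
      using 1 step by blast
  qed
qed

end

lemma uncountable_UNIV_omega1: "uncountable (UNIV :: omega1 set)"
  using uncountable_Field_cardSuc_natLeq countable_image[of UNIV Rep_omega1]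
  by (auto simp: type_definition.Rep_range[OF type_definition_omega1])

lemma countable_lessThan_omega1: "countable {..< \<alpha> :: omega1}"
  including cardinal_syntax
proof -
  let ?r = "cardSuc natLeq"
  have "|underS ?r (Rep_omega1 \<alpha>)| <o ?r"
    by (rule card_of_underS[OF cardSuc_natLeq(1) Rep_omega1])
  then have "|underS ?r (Rep_omega1 \<alpha>)| \<le>o natLeq"
    using cardSuc_ordLeq_ordLess[OF natLeq_Card_order card_of_Card_order] by blast
  then have "countable (underS ?r (Rep_omega1 \<alpha>))"
    by (simp add: countable_card_le_natLeq)
  moreover have "Rep_omega1 ` {..<\<alpha>} \<subseteq> underS ?r (Rep_omega1 \<alpha>)"
    by (auto simp: underS_def less_omega1_def less_eq_omega1.rep_eq Rep_omega1_inject)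
  ultimately have "countable (Rep_omega1 ` {..<\<alpha>})"
    by (rule countable_subset[rotated])
  then show ?thesis
    by (rule countable_image_inj_on) (auto simp: inj_on_def Rep_omega1_inject)
qed

definition osuc :: "omega1 \<Rightarrow> omega1"
  where "osuc \<alpha> = (LEAST \<beta>. \<alpha> < \<beta>)"

lemma less_osuc: "\<alpha> < osuc \<alpha>"
proof -
  have "countable {..\<alpha>}"
    using countable_lessThan_omega1[of \<alpha>] by (simp flip: ivl_disj_un_singleton(2))
  then have "{..\<alpha>} \<noteq> UNIV"
    using uncountable_UNIV_omega1 by metis
  then have "\<exists>\<beta>. \<alpha> < \<beta>"
    by (auto simp: not_le)
  then show ?thesis
    unfolding osuc_def by (rule LeastI_ex)
qed

lemma osuc_le: "\<alpha> < \<beta> \<Longrightarrow> osuc \<alpha> \<le> \<beta>"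
  unfolding osuc_def by (rule Least_le)


section \<open>Inverse sequences of length \<open>\<omega>\<^sub>1\<close>\<close>

text \<open>\<open>r \<alpha> \<beta>\<close> is the bonding map \<open>X \<beta> \<rightarrow> X \<alpha>\<close>, relevant only for \<open>\<alpha> \<le> \<beta>\<close>.\<close>

definition inverse_sequence ::
    "(omega1 \<Rightarrow> 'a topology) \<Rightarrow> (omega1 \<Rightarrow> omega1 \<Rightarrow> 'a \<Rightarrow> 'a) \<Rightarrow> bool"
  where "inverse_sequence X r \<longleftrightarrow>
    (\<forall>\<alpha>. compact_space (X \<alpha>) \<and> Hausdorff_space (X \<alpha>)) \<and>
    (\<forall>\<alpha> \<beta>. \<alpha> \<le> \<beta> \<longrightarrow>
       continuous_map (X \<beta>) (X \<alpha>) (r \<alpha> \<beta>) \<and>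
       r \<alpha> \<beta> ` topspace (X \<beta>) = topspace (X \<alpha>)) \<and>
    (\<forall>\<alpha>. \<forall>x \<in> topspace (X \<alpha>). r \<alpha> \<alpha> x = x) \<and>
    (\<forall>\<alpha> \<beta> \<gamma>. \<alpha> \<le> \<beta> \<longrightarrow> \<beta> \<le> \<gamma> \<longrightarrow>
       (\<forall>x \<in> topspace (X \<gamma>). r \<alpha> \<beta> (r \<beta> \<gamma> x) = r \<alpha> \<gamma> x))"

text \<open>The limit of the system restricted to \<open>T\<close>, as the space of threads in the product.\<close>

definition inverse_limit ::
    "omega1 set \<Rightarrow> (omega1 \<Rightarrow> 'a topology) \<Rightarrow> (omega1 \<Rightarrow> omega1 \<Rightarrow> 'a \<Rightarrow> 'a) \<Rightarrow> (omega1 \<Rightarrow> 'a) topology"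
  where "inverse_limit T X r =
    subtopology (product_topology X T)
      {x. \<forall>\<alpha>\<in>T. \<forall>\<beta>\<in>T. \<alpha> \<le> \<beta> \<longrightarrow> r \<alpha> \<beta> (x \<beta>) = x \<alpha>}"

text \<open>
  Directed sets are nonempty. Allowing \<open>T = {}\<close> (with supremum the least element) would force the
  first space of a continuous sequence to be a single point.
\<close>

definition directed :: "omega1 set \<Rightarrow> bool"
  where "directed T \<longleftrightarrow> T \<noteq> {} \<and> (\<forall>\<alpha>\<in>T. \<forall>\<beta>\<in>T. \<exists>\<gamma>\<in>T. \<alpha> \<le> \<gamma> \<and> \<beta> \<le> \<gamma>)"

definition is_supremum :: "omega1 \<Rightarrow> omega1 set \<Rightarrow> bool"
  where "is_supremum \<delta> T \<longleftrightarrow> (\<forall>\<alpha>\<in>T. \<alpha> \<le> \<delta>) \<and> (\<forall>\<gamma>. (\<forall>\<alpha>\<in>T. \<alpha> \<le> \<gamma>) \<longrightarrow> \<delta> \<le> \<gamma>)"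

text \<open>
  A cone over the system restricted to \<open>T\<close> is a limit iff the map that it induces into the space
  of threads is a homeomorphism.
\<close>

definition continuous_inverse_sequence ::
    "(omega1 \<Rightarrow> 'a topology) \<Rightarrow> (omega1 \<Rightarrow> omega1 \<Rightarrow> 'a \<Rightarrow> 'a) \<Rightarrow> bool"
  where "continuous_inverse_sequence X r \<longleftrightarrow>
    inverse_sequence X r \<and>
    (\<forall>T \<delta>. directed T \<longrightarrow> is_supremum \<delta> T \<longrightarrow>
       homeomorphic_map (X \<delta>) (inverse_limit T X r) (\<lambda>x. \<lambda>\<alpha>\<in>T. r \<alpha> \<delta> x))"


section \<open>Valdivia compact spaces\<close>

definition cube :: "'b set \<Rightarrow> ('b \<Rightarrow> real) topology"
  where "cube T = product_topology (\<lambda>_. top_of_set {0..1}) T"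

definition Sigma_product :: "'b set \<Rightarrow> ('b \<Rightarrow> real) set"
  where "Sigma_product T = {x \<in> topspace (cube T). countable {\<alpha> \<in> T. x \<alpha> \<noteq> 0}}"

definition Valdivia_embedding :: "'a topology \<Rightarrow> 'b set \<Rightarrow> ('a \<Rightarrow> 'b \<Rightarrow> real) \<Rightarrow> bool"
  where "Valdivia_embedding X T h \<longleftrightarrow>
    embedding_map X (cube T) h \<and>
    h ` topspace X = cube T closure_of (Sigma_product T \<inter> h ` topspace X)"

text \<open>
  The index set \<open>T\<close> is a set of real functions on the points of \<open>X\<close>, because a definition cannot
  quantify over types. This loses nothing: \<open>Valdivia_compactI\<close> below shows that \<open>T\<close> may be a subset
  of any type (identify the indices that give the same coordinate function on \<open>X\<close>).
\<close>

definition Valdivia_compact :: "'a topology \<Rightarrow> bool"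
  where "Valdivia_compact X \<longleftrightarrow>
    compact_space X \<and> Hausdorff_space X \<and>
    (\<exists>(T :: ('a \<Rightarrow> real) set) h. Valdivia_embedding X T h)"

lemma Hausdorff_space_cube: "Hausdorff_space (cube T)"
  by (simp add: cube_def Hausdorff_space_product_topology Hausdorff_space_subtopology)

lemma Valdivia_compactI:
  fixes T :: "'b set"
  assumes X: "compact_space X" "Hausdorff_space X" and h: "Valdivia_embedding X T h"
  shows "Valdivia_compact X"
proof -
  define p where "p = (\<lambda>\<alpha> x. h x \<alpha>)"
  define S where "S = p ` T"
  define g where "g = (\<lambda>x. \<lambda>\<phi>\<in>S. \<phi> x)"
  define D where "D = {x \<in> topspace X. h x \<in> Sigma_product T}"
  have emb: "embedding_map X (cube T) h"
    and cl: "h ` topspace X = cube T closure_of (Sigma_product T \<inter> h ` topspace X)"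
    using h by (auto simp: Valdivia_embedding_def)
  have hom: "homeomorphic_map X (subtopology (cube T) (h ` topspace X)) h"
    using emb by (simp add: embedding_map_def)
  have conth: "continuous_map X (cube T) h"
    using homeomorphic_imp_continuous_map[OF hom] continuous_map_into_fulltopology by blast
  have hT: "h x \<in> extensional T" if "x \<in> topspace X" for x
    using continuous_map_image_subset_topspace[OF conth] that by (auto simp: cube_def PiE_def)
  have "continuous_map X (top_of_set {0..1}) (\<lambda>x. h x \<alpha>)" if "\<alpha> \<in> T" for \<alpha>
    using conth that by (simp add: cube_def continuous_map_componentwise)
  then have contg: "continuous_map X (cube S) g"
    by (auto simp: cube_def continuous_map_componentwise g_def S_def p_def)
  have "inj_on g (topspace X)"
  proof
    fix x y assume xy: "x \<in> topspace X" "y \<in> topspace X" and eq: "g x = g y"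
    have "h x \<alpha> = h y \<alpha>" if "\<alpha> \<in> T" for \<alpha>
      using fun_cong[OF eq, of "p \<alpha>"] that by (simp add: g_def S_def p_def)
    then have "h x = h y"
      using hT xy by (auto intro: extensionalityI)
    then show "x = y"
      using homeomorphic_imp_injective_map[OF hom] xy by (auto dest: inj_onD)
  qed
  then have embg: "embedding_map X (cube S) g"
    using contg X Hausdorff_space_cube by (intro continuous_imp_embedding_map) auto
  have imD: "h ` D = Sigma_product T \<inter> h ` topspace X"
    by (auto simp: D_def)
  have "h ` (X closure_of D) = subtopology (cube T) (h ` topspace X) closure_of (h ` D)"
    using homeomorphic_map_closure_of[OF hom, of D] by (auto simp: D_def)
  also have "\<dots> = h ` topspace X"
    using cl by (simp add: closure_of_subtopology imD Int_absorb1 Int_commute)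
  finally have dense: "X closure_of D = topspace X"
    using homeomorphic_imp_injective_map[OF hom] closure_of_subset_topspace[of X D]
    by (metis inj_on_image_eq_iff order_refl)
  have supp: "{\<phi> \<in> S. g x \<phi> \<noteq> 0} \<subseteq> p ` {\<alpha> \<in> T. h x \<alpha> \<noteq> 0}" for x
    by (auto simp: S_def g_def p_def)
  have "g ` D \<subseteq> Sigma_product S \<inter> g ` topspace X"
    using continuous_map_image_subset_topspace[OF contg] countable_subset[OF supp]
    by (auto simp: D_def Sigma_product_def)
  then have "g ` topspace X \<subseteq> cube S closure_of (Sigma_product S \<inter> g ` topspace X)"
    using continuous_map_image_closure_subset[OF contg, of D] closure_of_mono
    unfolding dense by blast
  moreover have "closedin (cube S) (g ` topspace X)"
    using X(1) contg Hausdorff_space_cube compactin_imp_closedin image_compactin compact_space_def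
    by metis
  then have "cube S closure_of (Sigma_product S \<inter> g ` topspace X) \<subseteq> g ` topspace X"
    by (intro closure_of_minimal) auto
  ultimately have "Valdivia_embedding X S g"
    using embg by (auto simp: Valdivia_embedding_def)
  then show ?thesis
    using X by (auto simp: Valdivia_compact_def)
qed

end

theory Submission
  imports Defs
begin

text \<open>
  Choose right inverses \<open>s \<gamma>\<close> of \<open>r \<gamma> (osuc \<gamma>)\<close>. A point \<open>z\<close> of \<open>X \<alpha>\<close> extends to a thread that
  follows \<open>s \<gamma>\<close> at every successor step above \<open>\<alpha>\<close>; the threads so obtained (for all \<open>\<alpha>\<close> and \<open>z\<close>)
  are dense in the limit. On each \<open>X (osuc \<gamma>)\<close> there are countably many functions into \<open>[0,1]\<close>
  that vanish on the range of \<open>s \<gamma>\<close> and separate the points in each fibre of \<open>r \<gamma> (osuc \<gamma>)\<close>.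
  Together with countably many functions separating the points of the first space they embed
  the limit into a cube, because the least index where two threads differ cannot be a limit
  ordinal. On a thread that follows the right inverses above \<open>\<alpha>\<close>, only the functions
  belonging to some \<open>\<gamma> < \<alpha>\<close> can be nonzero, so its support is countable.
\<close>

section \<open>Separating functions on compact metrizable spaces\<close>

text \<open>Distances to the points of a countable dense set, cut off at 1, suffice: a dense point
  close enough to \<open>x\<close> is strictly nearer to \<open>x\<close> than to
  \<open>y\<close>.\<close>

lemma compact_metrizable_separating_functions:
  assumes "compact_space X" "metrizable_space X"
  obtains g :: "nat \<Rightarrow> 'a \<Rightarrow> real"
  where "\<And>n. continuous_map X (top_of_set {0..1}) (g n)"
    and "\<And>x y. x \<in> topspace X \<Longrightarrow> y \<in> topspace X \<Longrightarrow> x \<noteq> y \<Longrightarrow> \<exists>n. g n x \<noteq> g n y"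
proof -
  obtain M d where "Metric_space M d" and X: "X = Metric_space.mtopology M d"
    using assms(2) by (auto simp: metrizable_space_def)
  interpret Metric_space M d by fact
  have "mtotally_bounded M"
    using assms(1) X compact_space_eq_mcomplete_mtotally_bounded by blast
  then have "\<forall>n. \<exists>K. finite K \<and> K \<subseteq> M \<and> M \<subseteq> (\<Union>x\<in>K. mball x (1 / Suc n))"
    unfolding mtotally_bounded_def by simp
  then obtain K where K: "\<And>n. finite (K n)" "\<And>n. K n \<subseteq> M"
      "\<And>n. M \<subseteq> (\<Union>x\<in>K n. mball x (1 / Suc n))"
    unfolding choice_iff by blast
  \<comment> \<open>The finite \<open>1 / Suc n\<close>-nets given by total boundedness together
    form a countable dense set.\<close>
  define Q where "Q = (\<Union>n. K n)"
  have Q: "countable Q" "Q \<subseteq> M"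
    unfolding Q_def using K(1,2) by (blast intro: countable_UN countable_finite)+
  have dense: "\<exists>q\<in>Q. d q x < e" if "x \<in> M" "e > 0" for x e
  proof -
    obtain n where "1 / Suc n < e"
      using \<open>e > 0\<close> nat_approx_posE by blast
    moreover obtain q where "q \<in> K n" "d q x < 1 / Suc n"
      using subsetD[OF K(3)[of n] \<open>x \<in> M\<close>] by auto
    moreover have "q \<in> Q"
      using \<open>q \<in> K n\<close> unfolding Q_def by blast
    ultimately show ?thesis
      by (intro bexI[of _ q]) auto
  qed
  show thesis
  \<comment> \<open>An empty space has no dense point for \<open>from_nat_into\<close> to enumerate,
    so constant functions are used there.\<close>
  proof (cases "M = {}")
    case True
    then have "topspace X = {}"
      unfolding X topspace_mtopology .
    then show ?thesis
      by (intro that[of "\<lambda>_ _. 0"]) auto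
  next
    case False
    then have ne: "Q \<noteq> {}"
      using dense[OF _ zero_less_one] by blast
    then have q: "from_nat_into Q n \<in> M" for n
      using from_nat_into[OF ne] Q(2) by blast
    define g where "g = (\<lambda>n x. min 1 (d (from_nat_into Q n) x))"
    show ?thesis
    proof (rule that[of g])
      fix n
      have "continuous_map X euclideanreal (d (from_nat_into Q n))"
        using continuous_on_mdist[of "from_nat_into Q n" Self] q[of n]
        by (simp add: X mtopology_of_def)
      then have "continuous_map X euclideanreal (g n)"
        unfolding g_def by (intro continuous_map_real_min) simp_all
      then show "continuous_map X (top_of_set {0..1}) (g n)"
        by (simp add: continuous_map_in_subtopology g_def)
    next
      fix x y assume xy: "x \<in> topspace X" "y \<in> topspace X" "x \<noteq> y"
      then have M: "x \<in> M" "y \<in> M"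
        unfolding X topspace_mtopology by blast+
      then have pos: "d x y > 0"
        using xy(3) by simp
      \<comment> \<open>The bound \<open>d x y / 2\<close> makes \<open>q\<close> nearer to
        \<open>x\<close> than to \<open>y\<close>; the bound 1 keeps the cut-off from hiding
        this.\<close>
      then obtain q where q: "q \<in> Q" "d q x < min 1 (d x y / 2)"
        using dense[OF M(1), of "min 1 (d x y / 2)"] by force
      then have qM: "q \<in> M" using Q by auto
      obtain n where n: "from_nat_into Q n = q"
        using from_nat_into_surj[OF Q(1) q(1)] by blast
      have "d x y \<le> d q x + d q y"
        using triangle[OF M(1) qM M(2)] unfolding commute[of x q] .
      then have "d q x < d q y" "d q x < 1"
        using q(2) by linarith+
      then have "g n x < g n y"
        by (simp add: g_def n)
      then have "g n x \<noteq> g n y"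
        by simp
      then show "\<exists>n. g n x \<noteq> g n y" ..
    qed
  qed
qed

text \<open>The index in \<^typ>\<open>bool\<close> selects the positive or the negative part of \<open>g n x - g n (s (f x))\<close>.\<close>

lemma retraction_separating_functions:
  assumes X: "compact_space X" "metrizable_space X" and fs: "retraction_maps X Y f s"
  obtains g :: "nat \<times> bool \<Rightarrow> 'a \<Rightarrow> real"
  where "\<And>i. continuous_map X (top_of_set {0..1}) (g i)"
    and "\<And>i y. y \<in> topspace Y \<Longrightarrow> g i (s y) = 0"
    and "\<And>x x'. x \<in> topspace X \<Longrightarrow> x' \<in> topspace X \<Longrightarrow> f x = f x' \<Longrightarrow> x \<noteq> x' \<Longrightarrow>
           \<exists>i. g i x \<noteq> g i x'"
proof -
  obtain u :: "nat \<Rightarrow> 'a \<Rightarrow> real"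
    where u: "\<And>n. continuous_map X (top_of_set {0..1}) (u n)"
      and sep: "\<And>x y. x \<in> topspace X \<Longrightarrow> y \<in> topspace X \<Longrightarrow> x \<noteq> y \<Longrightarrow> \<exists>n. u n x \<noteq> u n y"
    using compact_metrizable_separating_functions[OF X] by blast
  have f: "continuous_map X Y f" and s: "continuous_map Y X s"
    and inv: "\<And>y. y \<in> topspace Y \<Longrightarrow> f (s y) = y"
    using fs by (auto simp: retraction_maps_def)
  \<comment> \<open>The subtracted term makes \<open>v n\<close> vanish on the range of
    \<open>s\<close>, where \<open>s (f x) = x\<close>. It is constant on each fibre of
    \<open>f\<close>, so there \<open>v n\<close> separates the same points as
    \<open>u n\<close>.\<close>
  define v where "v n x = u n x - u n (s (f x))" for n x
  define g where "g i x = max 0 (if snd i then v (fst i) x else - v (fst i) x)" for i x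
  have sf: "continuous_map X X (\<lambda>x. s (f x))"
    using continuous_map_compose[OF f s] by (simp add: o_def)
  have ur: "continuous_map X euclideanreal (u n)" and u01: "x \<in> topspace X \<Longrightarrow> u n x \<in> {0..1}" for n x
    using u[of n] by (auto simp: continuous_map_in_subtopology)
  have "continuous_map X euclideanreal (v n)" for n
    using continuous_map_compose[OF sf ur[of n]]
    unfolding v_def by (auto simp: o_def intro!: continuous_intros ur)
  then have "continuous_map X euclideanreal (g i)" for i
    unfolding g_def by (cases "snd i") (auto intro!: continuous_intros)
  moreover have "g i x \<in> {0..1}" if "x \<in> topspace X" for i x
  proof -
    have "s (f x) \<in> topspace X"
      using sf that by (auto simp: continuous_map_def)
    then show ?thesis
      using u01[OF that, of "fst i"] u01[of "s (f x)" "fst i"] by (auto simp: g_def v_def)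
  qed
  ultimately have 1: "continuous_map X (top_of_set {0..1}) (g i)" for i
    by (auto simp: continuous_map_in_subtopology)
  have 2: "g i (s y) = 0" if "y \<in> topspace Y" for i y
    using inv[OF that] by (simp add: g_def v_def)
  have 3: "\<exists>i. g i x \<noteq> g i x'"
    if x: "x \<in> topspace X" "x' \<in> topspace X" "x \<noteq> x'" and "f x = f x'" for x x'
  proof -
    obtain n where "u n x \<noteq> u n x'"
      using sep[OF x] by blast
    then have "v n x \<noteq> v n x'"
      using \<open>f x = f x'\<close> by (simp add: v_def)
    then have "g (n, True) x \<noteq> g (n, True) x' \<or> g (n, False) x \<noteq> g (n, False) x'"
      by (simp add: g_def)
    then show ?thesis by blast
  qed
  show thesis
    by (rule that[OF 1 2 3])
qed

section \<open>Inverse sequences\<close>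

lemma osuc_inject: "osuc \<alpha> = osuc \<beta> \<longleftrightarrow> \<alpha> = \<beta>"
  by (metis less_osuc osuc_le leD linorder_neqE)

lemma less_osuc_iff: "\<alpha> < osuc \<beta> \<longleftrightarrow> \<alpha> \<le> \<beta>"
  by (metis less_osuc osuc_le leD leI le_less_trans)

text \<open>Prepares the use of continuity at a limit ordinal. The element \<open>\<alpha>\<close>
  makes the initial segment nonempty, as \<open>directed\<close> demands. An upper bound
  \<open>\<gamma>\<close> below \<open>\<beta>\<close> is impossible, since
  \<open>osuc \<gamma>\<close> would still lie below \<open>\<beta>\<close>.\<close>

lemma limit_ordinal_lessThan:
  assumes "\<alpha> < \<beta>" and "\<And>\<gamma>. \<beta> \<noteq> osuc \<gamma>"
  shows "directed {..<\<beta>}" "is_supremum \<beta> {..<\<beta>}"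
proof -
  have "\<exists>\<gamma>\<in>{..<\<beta>}. a \<le> \<gamma> \<and> b \<le> \<gamma>" if "a < \<beta>" "b < \<beta>" for a b
    using that by (intro bexI[of _ "max a b"]) auto
  then show "directed {..<\<beta>}"
    using \<open>\<alpha> < \<beta>\<close> by (auto simp: directed_def)
  show "is_supremum \<beta> {..<\<beta>}"
    unfolding is_supremum_def
  proof (intro conjI allI impI)
    fix \<gamma> assume ub: "\<forall>a\<in>{..<\<beta>}. a \<le> \<gamma>"
    show "\<beta> \<le> \<gamma>"
    proof (rule ccontr)
      assume "\<not> \<beta> \<le> \<gamma>"
      then have "osuc \<gamma> < \<beta>"
        using osuc_le[of \<gamma> \<beta>] assms(2)[of \<gamma>] by (metis not_le order_less_le)
      then show False
        using ub less_osuc[of \<gamma>] by (meson leD lessThan_iff)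
    qed
  qed auto
qed

section \<open>Inverse limits as closed subspaces of products\<close>

lemma topspace_inverse_limit:
  "x \<in> topspace (inverse_limit T X r) \<longleftrightarrow>
    x \<in> extensional T \<and> (\<forall>\<alpha>\<in>T. x \<alpha> \<in> topspace (X \<alpha>)) \<and>
    (\<forall>\<alpha>\<in>T. \<forall>\<beta>\<in>T. \<alpha> \<le> \<beta> \<longrightarrow> r \<alpha> \<beta> (x \<beta>) = x \<alpha>)"
  by (auto simp: inverse_limit_def PiE_iff)

lemma continuous_map_inverse_limit_projection:
  "\<alpha> \<in> T \<Longrightarrow> continuous_map (inverse_limit T X r) (X \<alpha>) (\<lambda>x. x \<alpha>)"
  unfolding inverse_limit_def
  by (intro continuous_map_from_subtopology continuous_map_product_projection)

lemma inverse_sequenceD: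
  assumes "inverse_sequence X r"
  shows "compact_space (X \<alpha>)" "Hausdorff_space (X \<alpha>)"
    and "\<alpha> \<le> \<beta> \<Longrightarrow> continuous_map (X \<beta>) (X \<alpha>) (r \<alpha> \<beta>)"
    and "\<alpha> \<le> \<beta> \<Longrightarrow> x \<in> topspace (X \<beta>) \<Longrightarrow> r \<alpha> \<beta> x \<in> topspace (X \<alpha>)"
    and "x \<in> topspace (X \<alpha>) \<Longrightarrow> r \<alpha> \<alpha> x = x"
    and "\<alpha> \<le> \<beta> \<Longrightarrow> \<beta> \<le> \<gamma> \<Longrightarrow> x \<in> topspace (X \<gamma>) \<Longrightarrow> r \<alpha> \<beta> (r \<beta> \<gamma> x) = r \<alpha> \<gamma> x"
proof -
  have Hcomp: "\<forall>\<alpha>. compact_space (X \<alpha>) \<and> Hausdorff_space (X \<alpha>)"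
    and cont: "\<forall>\<alpha> \<beta>. \<alpha> \<le> \<beta> \<longrightarrow> continuous_map (X \<beta>) (X \<alpha>) (r \<alpha> \<beta>) \<and>
      r \<alpha> \<beta> ` topspace (X \<beta>) = topspace (X \<alpha>)"
    and id: "\<forall>\<alpha>. \<forall>x \<in> topspace (X \<alpha>). r \<alpha> \<alpha> x = x"
    and comp: "\<forall>\<alpha> \<beta> \<gamma>. \<alpha> \<le> \<beta> \<longrightarrow> \<beta> \<le> \<gamma> \<longrightarrow>
      (\<forall>x \<in> topspace (X \<gamma>). r \<alpha> \<beta> (r \<beta> \<gamma> x) = r \<alpha> \<gamma> x)"
    using assms unfolding inverse_sequence_def by - (elim conjE, assumption)+
  show "compact_space (X \<alpha>)" "Hausdorff_space (X \<alpha>)"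
    using Hcomp by simp_all
  show "\<alpha> \<le> \<beta> \<Longrightarrow> continuous_map (X \<beta>) (X \<alpha>) (r \<alpha> \<beta>)"
    using cont by simp
  show "\<alpha> \<le> \<beta> \<Longrightarrow> x \<in> topspace (X \<beta>) \<Longrightarrow> r \<alpha> \<beta> x \<in> topspace (X \<alpha>)"
    using cont by fast
  show "x \<in> topspace (X \<alpha>) \<Longrightarrow> r \<alpha> \<alpha> x = x"
    using id by simp
  show "\<alpha> \<le> \<beta> \<Longrightarrow> \<beta> \<le> \<gamma> \<Longrightarrow> x \<in> topspace (X \<gamma>) \<Longrightarrow> r \<alpha> \<beta> (r \<beta> \<gamma> x) = r \<alpha> \<gamma> x"
    using comp by simp
qed

lemma Hausdorff_inverse_limit:
  assumes "inverse_sequence X r"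
  shows "Hausdorff_space (inverse_limit T X r)"
  unfolding inverse_limit_def
  using inverse_sequenceD(2)[OF assms]
  by (simp add: Hausdorff_space_subtopology Hausdorff_space_product_topology)

text \<open>The threads form an intersection of equalizers of continuous maps into Hausdorff spaces,
  hence a closed subset of a product that is compact by Tychonoff's theorem.\<close>

lemma compact_inverse_limit:
  assumes "inverse_sequence X r"
  shows "compact_space (inverse_limit T X r)"
proof -
  note D = inverse_sequenceD[OF assms]
  let ?P = "product_topology X T"
  let ?E = "\<lambda>(\<alpha>, \<beta>). {x \<in> topspace ?P. r \<alpha> \<beta> (x \<beta>) = x \<alpha>}"
  let ?I = "{(\<alpha>, \<beta>). \<alpha> \<in> T \<and> \<beta> \<in> T \<and> \<alpha> \<le> \<beta>}"
  have "closedin ?P (?E (\<alpha>, \<beta>))" if "\<alpha> \<in> T" "\<beta> \<in> T" "\<alpha> \<le> \<beta>" for \<alpha> \<beta>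
  proof -
    have "continuous_map ?P (X \<alpha>) (\<lambda>x. r \<alpha> \<beta> (x \<beta>))"
      using continuous_map_compose[OF continuous_map_product_projection[OF that(2), of X] D(3)[OF that(3)]]
      by (simp add: o_def)
    then show ?thesis
      using closedin_continuous_maps_eq[OF D(2) _ continuous_map_product_projection[OF that(1)]]
      by simp
  qed
  \<comment> \<open>Inserting the whole space keeps the intersected family nonempty even when
    \<open>T\<close> is empty.\<close>
  then have "closedin ?P C" if "C \<in> insert (topspace ?P) (?E ` ?I)" for C
    using that by blast
  then have "closedin ?P (\<Inter> (insert (topspace ?P) (?E ` ?I)))"
    by (intro closedin_Inter) blast+
  then have "closedin ?P (topspace ?P \<inter> \<Inter> (?E ` ?I))"
    by simp
  moreover have "compact_space ?P"
    using D(1) by (simp add: compact_space_product_topology)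
  ultimately have "compact_space (subtopology ?P (topspace ?P \<inter> \<Inter> (?E ` ?I)))"
    by (intro compact_space_subtopology closedin_compact_space)
  moreover have "topspace ?P \<inter> \<Inter> (?E ` ?I) =
      topspace ?P \<inter> {x. \<forall>\<alpha>\<in>T. \<forall>\<beta>\<in>T. \<alpha> \<le> \<beta> \<longrightarrow> r \<alpha> \<beta> (x \<beta>) = x \<alpha>}"
    by blast
  ultimately show ?thesis
    by (simp only: inverse_limit_def subtopology_restrict)
qed

section \<open>Constructing, approximating and comparing threads\<close>

text \<open>Transfinite recursion: up to \<open>\<alpha>\<close> the values are the images of
  \<open>z\<close>, at later successors they come from \<open>s\<close>, and at later limit ordinals
  continuity supplies a point lying over all earlier values.\<close>

lemma thread_along_sections:
  assumes cont: "continuous_inverse_sequence X r"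
    and s: "\<And>\<gamma>. retraction_maps (X (osuc \<gamma>)) (X \<gamma>) (r \<gamma> (osuc \<gamma>)) (s \<gamma>)"
    and z: "z \<in> topspace (X \<alpha>)"
  obtains y where "y \<in> topspace (inverse_limit UNIV X r)" "y \<alpha> = z"
    and "\<And>\<gamma>. \<alpha> \<le> \<gamma> \<Longrightarrow> y (osuc \<gamma>) = s \<gamma> (y \<gamma>)"
proof -
  have inv: "inverse_sequence X r"
    using cont by (simp add: continuous_inverse_sequence_def)
  note D = inverse_sequenceD[OF inv]
  \<comment> \<open>\<open>w\<close> is an admissible value at \<open>\<beta>\<close> after the
    choices \<open>f\<close>. Only the values of \<open>f\<close> below \<open>\<beta>\<close>
    enter, as well-founded choice requires.\<close>
  define P where "P f \<beta> w \<longleftrightarrow> w \<in> topspace (X \<beta>) \<and> (\<forall>\<gamma><\<beta>. r \<gamma> \<beta> w = f \<gamma>) \<and>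
      (\<beta> \<le> \<alpha> \<longrightarrow> w = r \<beta> \<alpha> z) \<and> (\<forall>\<gamma>\<ge>\<alpha>. \<beta> = osuc \<gamma> \<longrightarrow> w = s \<gamma> (f \<gamma>))" for f \<beta> w
  have "\<exists>f. \<forall>\<beta>. P f \<beta> (f \<beta>)"
  proof (rule dependent_wf_choice[OF wf])
    fix f g :: "omega1 \<Rightarrow> 'a" and \<beta> w
    assume "\<And>\<gamma>. (\<gamma>, \<beta>) \<in> {(x, y). x < y} \<Longrightarrow> f \<gamma> = g \<gamma>"
    then show "P f \<beta> w = P g \<beta> w"
      using less_osuc by (auto simp: P_def)
  next
    fix \<beta> f assume "\<And>\<gamma>. (\<gamma>, \<beta>) \<in> {(x, y). x < y} \<Longrightarrow> P f \<gamma> (f \<gamma>)"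
    then have IH: "P f \<gamma> (f \<gamma>)" if "\<gamma> < \<beta>" for \<gamma>
      using that by auto
    consider "\<beta> \<le> \<alpha>" | \<gamma> where "\<alpha> < \<beta>" "\<beta> = osuc \<gamma>" | "\<alpha> < \<beta>" "\<And>\<gamma>. \<beta> \<noteq> osuc \<gamma>"
      by (metis leI)
    then show "\<exists>w. P f \<beta> w"
    proof cases
      case 1
      have "r \<gamma> \<beta> (r \<beta> \<alpha> z) = f \<gamma>" if "\<gamma> < \<beta>" for \<gamma>
        using IH[OF that] D(6)[of \<gamma> \<beta> \<alpha> z] 1 that z by (simp add: P_def)
      \<comment> \<open>The clause of \<open>P\<close> about \<open>s\<close> is therefore vacuous
        up to \<open>\<alpha>\<close>.\<close>
      moreover have "\<beta> \<noteq> osuc \<gamma>" if "\<alpha> \<le> \<gamma>" for \<gamma>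
        using 1 that less_osuc[of \<gamma>] by auto
      ultimately have "P f \<beta> (r \<beta> \<alpha> z)"
        using D(4)[OF 1 z] by (simp add: P_def)
      then show ?thesis ..
    next
      case 2
      have \<gamma>: "P f \<gamma> (f \<gamma>)"
        using IH 2 less_osuc by simp
      then have f\<gamma>: "f \<gamma> \<in> topspace (X \<gamma>)"
        by (simp add: P_def)
      have w: "s \<gamma> (f \<gamma>) \<in> topspace (X \<beta>)" "r \<gamma> \<beta> (s \<gamma> (f \<gamma>)) = f \<gamma>"
        using s[of \<gamma>] f\<gamma> by (auto simp: retraction_maps_def 2(2) continuous_map_def)
      have "r \<delta> \<beta> (s \<gamma> (f \<gamma>)) = f \<delta>" if "\<delta> < \<beta>" for \<delta>
      proof -
        have le: "\<delta> \<le> \<gamma>"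
          using that 2 less_osuc_iff by simp
        have "\<gamma> \<le> \<beta>"
          using 2 less_osuc[of \<gamma>] by simp
        have "r \<delta> \<beta> (s \<gamma> (f \<gamma>)) = r \<delta> \<gamma> (f \<gamma>)"
          using D(6)[OF le \<open>\<gamma> \<le> \<beta>\<close> w(1)] w(2) by simp
        also have "\<dots> = f \<delta>"
          using \<gamma> le D(5)[OF f\<gamma>] by (cases "\<delta> = \<gamma>") (auto simp: P_def)
        finally show ?thesis .
      qed
      then have "P f \<beta> (s \<gamma> (f \<gamma>))"
        using w(1) 2 by (auto simp: P_def osuc_inject)
      then show ?thesis ..
    next
      case 3
      \<comment> \<open>The values chosen so far form a thread over \<open>{..<\<beta>}\<close>;
        surjectivity of this map yields a point of \<open>X \<beta>\<close> inducing it.\<close>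
      have hom: "homeomorphic_map (X \<beta>) (inverse_limit {..<\<beta>} X r) (\<lambda>x. \<lambda>\<gamma>\<in>{..<\<beta>}. r \<gamma> \<beta> x)"
        using cont limit_ordinal_lessThan[OF 3] by (simp add: continuous_inverse_sequence_def)
      have "r a b (f b) = f a" if "a \<le> b" "b < \<beta>" for a b
        using IH[OF that(2)] that D(5) by (cases "a = b") (auto simp: P_def)
      moreover have "f a \<in> topspace (X a)" if "a < \<beta>" for a
        using IH[OF that] by (simp add: P_def)
      ultimately have "restrict f {..<\<beta>} \<in> topspace (inverse_limit {..<\<beta>} X r)"
        by (auto simp: topspace_inverse_limit)
      then obtain w where w: "w \<in> topspace (X \<beta>)"
          "(\<lambda>\<gamma>\<in>{..<\<beta>}. r \<gamma> \<beta> w) = restrict f {..<\<beta>}"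
        using homeomorphic_imp_surjective_map[OF hom] by (metis (no_types, lifting) imageE)
      have "r \<gamma> \<beta> w = f \<gamma>" if "\<gamma> < \<beta>" for \<gamma>
        using fun_cong[OF w(2), of \<gamma>] that by simp
      then have "P f \<beta> w"
        using w(1) 3 by (auto simp: P_def)
      then show ?thesis ..
    qed
  qed
  then obtain y where y: "\<And>\<beta>. P y \<beta> (y \<beta>)"
    by blast
  show thesis
  proof (rule that[of y])
    have "r a b (y b) = y a" if "a \<le> b" for a b
      using y[of b] that D(5) by (cases "a = b") (auto simp: P_def)
    then show "y \<in> topspace (inverse_limit UNIV X r)"
      using y by (auto simp: topspace_inverse_limit P_def)
    show "y \<alpha> = z"
      using y[of \<alpha>] D(5)[OF z] by (simp add: P_def)
    show "y (osuc \<gamma>) = s \<gamma> (y \<gamma>)" if "\<alpha> \<le> \<gamma>" for \<gamma>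
      using y[of "osuc \<gamma>"] that by (simp add: P_def)
  qed
qed

text \<open>A basic open set of the product restricts finitely many coordinates. Agreement of two
  threads at an index above all of these forces agreement at each of them, so one coordinate at a
  time is enough for density.\<close>

lemma dense_inverse_limit:
  assumes S: "S \<subseteq> topspace (inverse_limit UNIV X r)"
    and ex: "\<And>\<alpha> x. x \<in> topspace (inverse_limit UNIV X r) \<Longrightarrow> \<exists>y\<in>S. y \<alpha> = x \<alpha>"
  shows "inverse_limit UNIV X r closure_of S = topspace (inverse_limit UNIV X r)" (is "?L closure_of S = _")
proof (rule antisym[OF closure_of_subset_topspace], rule subsetI)
  fix x assume x: "x \<in> topspace ?L"
  have "\<exists>y. y \<in> S \<and> y \<in> U" if U: "x \<in> U" "openin ?L U" for U
  proof -
    obtain V where V: "openin (product_topology X UNIV) V"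
        and UV: "U = V \<inter> {x. \<forall>\<alpha>\<in>UNIV. \<forall>\<beta>\<in>UNIV. \<alpha> \<le> \<beta> \<longrightarrow> r \<alpha> \<beta> (x \<beta>) = x \<alpha>}"
      using U(2) by (auto simp: inverse_limit_def openin_subtopology)
    obtain B where B: "x \<in> (\<Pi>\<^sub>E i\<in>UNIV. B i)" "finite {i. B i \<noteq> topspace (X i)}"
        "(\<Pi>\<^sub>E i\<in>UNIV. B i) \<subseteq> V"
      using product_topology_open_contains_basis[OF V, of x] U(1) UV by blast
    let ?F = "{i. B i \<noteq> topspace (X i)}"
    obtain \<alpha> where \<alpha>: "\<And>i. i \<in> ?F \<Longrightarrow> i \<le> \<alpha>"
      using B(2) by (metis Max_ge)
    obtain y where y: "y \<in> S" "y \<alpha> = x \<alpha>"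
      using ex[OF x] by blast
    have thr: "y \<in> topspace ?L"
      using S y by blast
    have "y i \<in> B i" for i
    proof (cases "i \<in> ?F")
      case True
      then have "y i = x i"
        using \<alpha> thr x y(2) unfolding topspace_inverse_limit by (metis UNIV_I)
      then show ?thesis
        using B(1) by auto
    next
      case False
      then show ?thesis
        using thr by (auto simp: topspace_inverse_limit)
    qed
    then have "y \<in> U"
      using B(3) thr by (auto simp: UV topspace_inverse_limit)
    then show ?thesis
      using y by blast
  qed
  then show "x \<in> ?L closure_of S"
    using x by (auto simp: in_closure_of)
qed

text \<open>At a limit ordinal, continuity makes a coordinate determined by the earlier ones, so the
  least index of disagreement is the first ordinal or a successor.\<close>

lemma first_difference:
  assumes cont: "continuous_inverse_sequence X r"
    and x: "x \<in> topspace (inverse_limit UNIV X r)" and y: "y \<in> topspace (inverse_limit UNIV X r)"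
    and "x \<noteq> y" and bot0: "\<And>\<alpha>. bot0 \<le> \<alpha>"
  shows "x bot0 \<noteq> y bot0 \<or> (\<exists>\<gamma>. x \<gamma> = y \<gamma> \<and> x (osuc \<gamma>) \<noteq> y (osuc \<gamma>))"
proof -
  define \<beta> where "\<beta> = (LEAST \<beta>. x \<beta> \<noteq> y \<beta>)"
  have \<beta>: "x \<beta> \<noteq> y \<beta>"
    unfolding \<beta>_def by (rule LeastI_ex) (use \<open>x \<noteq> y\<close> in auto)
  have below: "x \<gamma> = y \<gamma>" if "\<gamma> < \<beta>" for \<gamma>
    using not_less_Least[of \<gamma> "\<lambda>\<beta>. x \<beta> \<noteq> y \<beta>"] that by (auto simp: \<beta>_def)
  consider "\<beta> = bot0" | \<gamma> where "\<beta> = osuc \<gamma>" | "bot0 < \<beta>" "\<And>\<gamma>. \<beta> \<noteq> osuc \<gamma>"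
    using bot0[of \<beta>] by (metis le_neq_trans)
  then show ?thesis
  proof cases
    case 3
    have hom: "homeomorphic_map (X \<beta>) (inverse_limit {..<\<beta>} X r) (\<lambda>x. \<lambda>\<gamma>\<in>{..<\<beta>}. r \<gamma> \<beta> x)"
      using cont limit_ordinal_lessThan[OF 3] by (simp add: continuous_inverse_sequence_def)
    have "r \<gamma> \<beta> (x \<beta>) = r \<gamma> \<beta> (y \<beta>)" if "\<gamma> < \<beta>" for \<gamma>
      using x y below[OF that] that by (simp add: topspace_inverse_limit)
    then have "(\<lambda>\<gamma>\<in>{..<\<beta>}. r \<gamma> \<beta> (x \<beta>)) = (\<lambda>\<gamma>\<in>{..<\<beta>}. r \<gamma> \<beta> (y \<beta>))"
      by auto
    then have "x \<beta> = y \<beta>"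
      using homeomorphic_imp_injective_map[OF hom] x y
      by (auto simp: topspace_inverse_limit dest: inj_onD)
    then show ?thesis
      using \<beta> by simp
  qed (use \<beta> below less_osuc in auto)
qed

section \<open>The embedding of the limit into a cube\<close>

theorem corollary4p3:
  fixes X :: "omega1 \<Rightarrow> 'a topology"
    and r :: "omega1 \<Rightarrow> omega1 \<Rightarrow> 'a \<Rightarrow> 'a"
  assumes "continuous_inverse_sequence X r"
    and "\<And>\<alpha>. compact_space (X \<alpha>) \<and> metrizable_space (X \<alpha>)"
    and "\<And>\<alpha>. retraction_map (X (osuc \<alpha>)) (X \<alpha>) (r \<alpha> (osuc \<alpha>))"
  shows "Valdivia_compact (inverse_limit UNIV X r)"
proof -
  let ?L = "inverse_limit UNIV X r"
  have inv: "inverse_sequence X r"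
    using assms(1) by (simp add: continuous_inverse_sequence_def)
  obtain s where s: "\<And>\<gamma>. retraction_maps (X (osuc \<gamma>)) (X \<gamma>) (r \<gamma> (osuc \<gamma>)) (s \<gamma>)"
    using assms(3) unfolding retraction_map_def by metis
  \<comment> \<open>The first space lies over no earlier one, so its points need separating
    functions of their own.\<close>
  define b :: omega1 where "b = (LEAST \<beta>. True)"
  have b: "b \<le> \<alpha>" for \<alpha>
    unfolding b_def by (rule Least_le) simp
  obtain u :: "nat \<Rightarrow> 'a \<Rightarrow> real"
    where u: "\<And>n. continuous_map (X b) (top_of_set {0..1}) (u n)"
      and u_sep: "\<And>x y. x \<in> topspace (X b) \<Longrightarrow> y \<in> topspace (X b) \<Longrightarrow> x \<noteq> y \<Longrightarrow> \<exists>n. u n x \<noteq> u n y"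
    using compact_metrizable_separating_functions assms(2) by metis
  \<comment> \<open>All three properties are gathered under one quantifier so that a family can be
    chosen for all \<open>\<gamma>\<close> at once.\<close>
  have "\<exists>g :: nat \<times> bool \<Rightarrow> 'a \<Rightarrow> real.
      (\<forall>i. continuous_map (X (osuc \<gamma>)) (top_of_set {0..1}) (g i)) \<and>
      (\<forall>i. \<forall>y\<in>topspace (X \<gamma>). g i (s \<gamma> y) = 0) \<and>
      (\<forall>x\<in>topspace (X (osuc \<gamma>)). \<forall>x'\<in>topspace (X (osuc \<gamma>)).
        r \<gamma> (osuc \<gamma>) x = r \<gamma> (osuc \<gamma>) x' \<longrightarrow> x \<noteq> x' \<longrightarrow> (\<exists>i. g i x \<noteq> g i x'))" for \<gamma>
    using retraction_separating_functions[OF _ _ s, of \<gamma>] assms(2)[of "osuc \<gamma>"] by metis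
  then obtain g :: "omega1 \<Rightarrow> nat \<times> bool \<Rightarrow> 'a \<Rightarrow> real"
    where g: "\<And>\<gamma> i. continuous_map (X (osuc \<gamma>)) (top_of_set {0..1}) (g \<gamma> i)"
      and g_zero: "\<And>\<gamma> i y. y \<in> topspace (X \<gamma>) \<Longrightarrow> g \<gamma> i (s \<gamma> y) = 0"
      and g_sep: "\<And>\<gamma> x x'. x \<in> topspace (X (osuc \<gamma>)) \<Longrightarrow> x' \<in> topspace (X (osuc \<gamma>)) \<Longrightarrow>
        r \<gamma> (osuc \<gamma>) x = r \<gamma> (osuc \<gamma>) x' \<Longrightarrow> x \<noteq> x' \<Longrightarrow> \<exists>i. g \<gamma> i x \<noteq> g \<gamma> i x'"
    by metis
  \<comment> \<open>The left summand indexes the countably many functions on the first space, the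
    right one those attached to the successor steps.\<close>
  define h where "h x t = (case t of Inl n \<Rightarrow> u n (x b) | Inr (\<gamma>, i) \<Rightarrow> g \<gamma> i (x (osuc \<gamma>)))"
    for x :: "omega1 \<Rightarrow> 'a" and t :: "nat + omega1 \<times> nat \<times> bool"
  note proj = continuous_map_inverse_limit_projection[OF UNIV_I, of X r]
  have "continuous_map ?L (top_of_set {0..1}) (\<lambda>x. h x t)" for t
    using continuous_map_compose[OF proj u] continuous_map_compose[OF proj g]
    by (cases t) (auto simp: h_def o_def)
  then have h: "continuous_map ?L (cube UNIV) h"
    by (simp add: cube_def continuous_map_componentwise_UNIV)
  have "inj_on h (topspace ?L)"
  proof (rule inj_onI, rule ccontr)
    fix x y assume x: "x \<in> topspace ?L" and y: "y \<in> topspace ?L" and eq: "h x = h y" and "x \<noteq> y"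
    have u_eq: "u n (x b) = u n (y b)" for n
      using fun_cong[OF eq, of "Inl n"] by (simp add: h_def)
    have g_eq: "g \<gamma> i (x (osuc \<gamma>)) = g \<gamma> i (y (osuc \<gamma>))" for \<gamma> i
      using fun_cong[OF eq, of "Inr (\<gamma>, i)"] by (simp add: h_def)
    have xy: "x \<alpha> \<in> topspace (X \<alpha>)" "y \<alpha> \<in> topspace (X \<alpha>)" for \<alpha>
      using x y by (auto simp: topspace_inverse_limit)
    have "x b = y b"
      using u_sep[OF xy] u_eq by blast
    then obtain \<gamma> where "x \<gamma> = y \<gamma>" "x (osuc \<gamma>) \<noteq> y (osuc \<gamma>)"
      using first_difference[OF assms(1) x y \<open>x \<noteq> y\<close> b] by blast
    moreover have "r \<gamma> (osuc \<gamma>) (x (osuc \<gamma>)) = x \<gamma>" "r \<gamma> (osuc \<gamma>) (y (osuc \<gamma>)) = y \<gamma>"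
      using x y less_osuc[of \<gamma>] by (auto simp: topspace_inverse_limit)
    ultimately show False
      using g_sep[OF xy] g_eq by metis
  qed
  then have emb: "embedding_map ?L (cube UNIV) h"
    using h compact_inverse_limit[OF inv] Hausdorff_space_cube
    by (intro continuous_imp_embedding_map)
  \<comment> \<open>The threads that eventually follow the right inverses: a dense set that
    \<open>h\<close> sends into the Sigma-product.\<close>
  define D where "D = {y \<in> topspace ?L. \<exists>\<alpha>. \<forall>\<gamma>\<ge>\<alpha>. y (osuc \<gamma>) = s \<gamma> (y \<gamma>)}"
  have dense: "?L closure_of D = topspace ?L"
  proof (rule dense_inverse_limit)
    fix \<alpha> x assume "x \<in> topspace ?L"
    then have "x \<alpha> \<in> topspace (X \<alpha>)"
      by (simp add: topspace_inverse_limit)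
    then obtain y where "y \<in> topspace ?L" "y \<alpha> = x \<alpha>" "\<And>\<gamma>. \<alpha> \<le> \<gamma> \<Longrightarrow> y (osuc \<gamma>) = s \<gamma> (y \<gamma>)"
      using thread_along_sections[OF assms(1) s] by blast
    then show "\<exists>y\<in>D. y \<alpha> = x \<alpha>"
      by (auto simp: D_def)
  qed (simp add: D_def)
  have "countable {t. h y t \<noteq> 0}" if "y \<in> D" for y
  proof -
    from \<open>y \<in> D\<close> obtain \<alpha> where y: "y \<in> topspace ?L" and \<alpha>: "\<And>\<gamma>. \<alpha> \<le> \<gamma> \<Longrightarrow> y (osuc \<gamma>) = s \<gamma> (y \<gamma>)"
      by (auto simp: D_def)
    have "g \<gamma> i (y (osuc \<gamma>)) = 0" if "\<alpha> \<le> \<gamma>" for \<gamma> i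
      using \<alpha>[OF that] g_zero y by (simp add: topspace_inverse_limit)
    \<comment> \<open>This bound is countable because proper initial segments of
      \<open>omega1\<close> are.\<close>
    then have "{t. h y t \<noteq> 0} \<subseteq> range Inl \<union> Inr ` ({..<\<alpha>} \<times> UNIV)"
      by (force simp: h_def not_le[symmetric] split: sum.splits)
    then show ?thesis
      by (rule countable_subset) (intro countable_Un countable_image countable_SIGMA
          countable_lessThan_omega1 countableI_type)
  qed
  moreover have "h ` topspace ?L \<subseteq> topspace (cube UNIV)"
    using continuous_map_image_subset_topspace[OF h] .
  ultimately have "h ` D \<subseteq> Sigma_product UNIV \<inter> h ` topspace ?L"
    by (auto simp: Sigma_product_def D_def)
  \<comment> \<open>Continuity of \<open>h\<close> carries the density of \<open>D\<close> over to
    the image; the reverse inclusion follows from compactness, which makes the image closed.\<close>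
  then have "h ` topspace ?L \<subseteq> cube UNIV closure_of (Sigma_product UNIV \<inter> h ` topspace ?L)"
    using continuous_map_image_closure_subset[OF h, of D] closure_of_mono
    unfolding dense by blast
  moreover have "closedin (cube UNIV) (h ` topspace ?L)"
    using compact_inverse_limit[OF inv] h Hausdorff_space_cube compactin_imp_closedin
      image_compactin compact_space_def by metis
  then have "cube UNIV closure_of (Sigma_product UNIV \<inter> h ` topspace ?L) \<subseteq> h ` topspace ?L"
    by (intro closure_of_minimal) auto
  ultimately have "Valdivia_embedding ?L UNIV h"
    using emb by (auto simp: Valdivia_embedding_def)
  then show ?thesis
    using Valdivia_compactI compact_inverse_limit[OF inv] Hausdorff_inverse_limit[OF inv] by blast
qed

end
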